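(* There exists a metric Sierpiński carpet, i.e., a metric space homeomorphic to the standard Sierpiński carpet, that is quasisymmetrically co-Hopfian.
   Context: The standard Sierpiński carpet $S_3$ is the planar set obtained from the closed unit square by subdividing it into $9$ equal subsquares, removing the open middle one, and repeating this on the remaining subsquares indefinitely. A homeomorphism $f$ between metric spaces $(X,d_X)$ and $(Y,d_Y)$ is quasisymmetric if there is a homeomorphism $\eta\colon[0,\infty)\to[0,\infty)$ such that $$\frac{d_Y(f(p),f(q))}{d_Y(f(p),f(q'))}\le\eta\bigg(\frac{d_X(p,q)}{d_X(p,q')}\bigg)$$ for all triples of distinct points $p,q,q'\in X$. A quasisymmetric embedding of $(X,d_X)$ into $(Y,d_Y)$ is a one-to-one continuous map $f\colon X\to Y$ that is quasisymmetric as a map from $(X,d_X)$ to $(f(X),d_Y)$. A metric space $X$ is quasisymmetrically co-Hopfian if every quasisymmetric embedding of $X$ into itself is onto. *)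

theory Defs
  imports "HOL-Analysis.Analysis"
begin

text \<open>Lower left corners of the closed squares of side \<open>1/3^n\<close> that remain after \<open>n\<close> steps
  of the construction of the standard carpet.\<close>

fun carpet_corners :: "nat \<Rightarrow> (real \<times> real) set" where
  "carpet_corners 0 = {(0, 0)}"
| "carpet_corners (Suc n) =
     {(x + real i / 3 ^ Suc n, y + real j / 3 ^ Suc n) | x y i j.
        (x, y) \<in> carpet_corners n \<and> i < 3 \<and> j < 3 \<and> (i, j) \<noteq> (1, 1)}"

definition open_middle_square :: "nat \<Rightarrow> real \<times> real \<Rightarrow> (real \<times> real) set" where
  "open_middle_square n c =
     {fst c + 1 / 3 ^ Suc n <..< fst c + 2 / 3 ^ Suc n} \<times>
     {snd c + 1 / 3 ^ Suc n <..< snd c + 2 / 3 ^ Suc n}"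

fun carpet_stage :: "nat \<Rightarrow> (real \<times> real) set" where
  "carpet_stage 0 = {0..1} \<times> {0..1}"
| "carpet_stage (Suc n) = carpet_stage n - (\<Union>c\<in>carpet_corners n. open_middle_square n c)"

definition standard_carpet :: "(real \<times> real) set" where
  "standard_carpet = (\<Inter>n. carpet_stage n)"

definition metric_sierpinski_carpet :: "'a metric \<Rightarrow> bool" where
  "metric_sierpinski_carpet X \<longleftrightarrow>
     mtopology_of X homeomorphic_space top_of_set standard_carpet"

definition quasisymmetric_map :: "'a metric \<Rightarrow> 'b metric \<Rightarrow> ('a \<Rightarrow> 'b) \<Rightarrow> bool" where
  "quasisymmetric_map X Y f \<longleftrightarrow>
     homeomorphic_map (mtopology_of X) (mtopology_of Y) f \<and>
     (\<exists>\<eta> \<eta>' :: real \<Rightarrow> real. homeomorphism {0..} {0..} \<eta> \<eta>' \<and>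
        (\<forall>p\<in>mspace X. \<forall>q\<in>mspace X. \<forall>q'\<in>mspace X.
           p \<noteq> q \<and> p \<noteq> q' \<and> q \<noteq> q' \<longrightarrow>
           mdist Y (f p) (f q) / mdist Y (f p) (f q') \<le> \<eta> (mdist X p q / mdist X p q')))"

definition quasisymmetric_embedding :: "'a metric \<Rightarrow> 'b metric \<Rightarrow> ('a \<Rightarrow> 'b) \<Rightarrow> bool" where
  "quasisymmetric_embedding X Y f \<longleftrightarrow>
     inj_on f (mspace X) \<and>
     continuous_map (mtopology_of X) (mtopology_of Y) f \<and>
     quasisymmetric_map X (submetric Y (f ` mspace X)) f"

definition quasisymmetrically_co_Hopfian :: "'a metric \<Rightarrow> bool" where
  "quasisymmetrically_co_Hopfian X \<longleftrightarrow>
     (\<forall>f. quasisymmetric_embedding X X f \<longrightarrow> f ` mspace X = mspace X)"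

end

theory Submission
  imports Defs
begin

text \<open>
  Only two properties of the carpet matter: it is totally bounded and connected. Let \<open>S\<close> be such a
  space. Choose a sequence of centers in which each point of a countable dense set occurs infinitely
  often, and rapidly decreasing scales \<open>s n\<close>. Take the supremum of the original metric and of
  pseudometrics of diameter \<open>s n\<close>, the \<open>n\<close>-th of which lives only in a tiny ball around the \<open>n\<close>-th
  center \<open>a\<close> and creates there \<open>N n\<close> points that have distance \<open>s n\<close> from \<open>a\<close> and are
  \<open>s n\<close>-separated.

  A quasisymmetric map \<open>f\<close> satisfies a lower Hoelder estimate at \<open>a\<close>, obtained by repeatedly halving
  the distance to \<open>a\<close>, which is possible because \<open>S\<close> is connected. Hence for large \<open>n\<close> it carries
  these points to \<open>N n\<close> points near \<open>f a\<close> that are \<open>(s n)^n\<close>-separated. If \<open>f a \<noteq> a\<close>, then near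
  \<open>f a\<close> the \<open>n\<close>-th pseudometric vanishes, the later ones are smaller than \<open>(s n)^n\<close>, and the earlier
  ones are Lipschitz with a constant fixed before \<open>N n\<close>; so a choice of \<open>N n\<close> larger than the
  cardinality that total boundedness of \<open>S\<close> allows gives a contradiction. Therefore \<open>f\<close> fixes every
  center, and by density it is the identity.
\<close>

subsection \<open>Separated sets and equispaced points\<close>

definition separated :: "('a \<Rightarrow> 'a \<Rightarrow> real) \<Rightarrow> real \<Rightarrow> 'a set \<Rightarrow> bool" where
  "separated d \<delta> T \<longleftrightarrow> pairwise (\<lambda>x y. \<delta> \<le> d x y) T"

text \<open>Infinite sets \<open>T\<close> contribute \<open>card T = 0\<close>; if \<open>0 < \<delta>\<close>, a totally bounded \<open>S\<close> contains none.\<close>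

definition packing_number :: "'a::metric_space set \<Rightarrow> real \<Rightarrow> nat" where
  "packing_number S \<delta> = (SUP T\<in>{T. T \<subseteq> S \<and> separated dist \<delta> T}. card T)"

lemma separated_mono: "separated d \<delta> T \<Longrightarrow> \<epsilon> \<le> \<delta> \<Longrightarrow> separated d \<epsilon> T"
  unfolding separated_def by (erule pairwise_mono) auto

lemma totally_bounded_imp_separated_card_le:
  fixes S :: "'a::metric_space set"
  assumes "totally_bounded S" "0 < \<delta>"
  obtains B where "\<And>T. \<lbrakk>T \<subseteq> S; separated dist \<delta> T\<rbrakk> \<Longrightarrow> card T \<le> B"
proof -
  obtain K where K: "finite K" "S \<subseteq> (\<Union>k\<in>K. ball k (\<delta> / 2))"
    using assms unfolding totally_bounded_metric ball_def by (meson half_gt_zero)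
  have "card T \<le> card K" if "T \<subseteq> S" and sep: "separated dist \<delta> T" for T
  proof -
    have "\<forall>x\<in>T. \<exists>k\<in>K. dist k x < \<delta> / 2"
      using K(2) \<open>T \<subseteq> S\<close> by fastforce
    then obtain g where g: "\<And>x. x \<in> T \<Longrightarrow> g x \<in> K \<and> dist (g x) x < \<delta> / 2"
      by metis
    have "inj_on g T"
    proof (rule inj_onI, rule ccontr)
      fix x y assume xy: "x \<in> T" "y \<in> T" "g x = g y" "x \<noteq> y"
      have "dist x y < \<delta>"
        using g[OF xy(1)] g[OF xy(2)] xy(3) dist_triangle_half_r by metis
      then show False
        using sep xy unfolding separated_def pairwise_def by force
    qed
    then show ?thesis
      using g K(1) by (intro card_inj_on_le) auto
  qed
  then show thesis
    by (rule that)
qed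

lemma card_le_packing_number:
  assumes "totally_bounded S" "0 < \<delta>" "T \<subseteq> S" "separated dist \<delta> T"
  shows "card T \<le> packing_number S \<delta>"
proof -
  obtain B where "\<And>T. \<lbrakk>T \<subseteq> S; separated dist \<delta> T\<rbrakk> \<Longrightarrow> card T \<le> B"
    using totally_bounded_imp_separated_card_le[OF assms(1,2)] by blast
  then show ?thesis
    unfolding packing_number_def using assms(3,4)
    by (intro cSUP_upper bdd_aboveI2[where M = B]) auto
qed

lemma connected_space_mdist_attains:
  assumes "connected_space (mtopology_of X)" "a \<in> mspace X" "z \<in> mspace X"
    and "0 \<le> r" "r \<le> mdist X a z"
  obtains y where "y \<in> mspace X" "mdist X a y = r"
proof -
  have "connected (mdist X a ` mspace X)"
    using assms(1)
      connectedin_continuous_map_image[OF continuous_on_mdist[OF assms(2)], of "mspace X"]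
    by (simp flip: topspace_mtopology_of add: connectedin_topspace)
  moreover have "mdist X a a = 0"
    using assms(2) by simp
  ultimately have "r \<in> mdist X a ` mspace X"
    using assms(2-5) unfolding connected_iff_interval by (metis imageI)
  then show thesis
    using that by blast
qed

lemma connected_space_equispaced_points:
  assumes "connected_space (mtopology_of X)" "a \<in> mspace X" "z \<in> mspace X"
    and "0 \<le> r" "r \<le> mdist X a z"
  obtains x :: "nat \<Rightarrow> 'a" where "x 0 = a"
    and "\<And>i. i \<le> N \<Longrightarrow> x i \<in> mspace X"
    and "\<And>i. i \<le> N \<Longrightarrow> mdist X a (x i) = r * i / N"
proof -
  have "\<exists>y\<in>mspace X. mdist X a y = r * i / N" if "i \<le> N" for i
  proof -
    have "r * (i / N) \<le> r * 1"
      using that \<open>0 \<le> r\<close> by (intro mult_left_mono) (auto simp: divide_le_eq)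
    then show ?thesis
      using connected_space_mdist_attains[OF assms(1-3), of "r * i / N"] assms(4,5) by auto
  qed
  then obtain x where x: "\<And>i. i \<le> N \<Longrightarrow> x i \<in> mspace X \<and> mdist X a (x i) = r * i / N"
    by metis
  moreover have "x 0 = a"
    using x[of 0] \<open>a \<in> mspace X\<close> by auto
  ultimately show thesis
    using that by blast
qed

subsection \<open>Distortion of relative distances\<close>

definition relative_distortion_le ::
    "'a metric \<Rightarrow> 'b metric \<Rightarrow> ('a \<Rightarrow> 'b) \<Rightarrow> real \<Rightarrow> real \<Rightarrow> bool" where
  "relative_distortion_le X Y f R H \<longleftrightarrow>
     (\<forall>x\<in>mspace X. \<forall>y\<in>mspace X. \<forall>z\<in>mspace X.
        mdist X x y \<le> R * mdist X x z \<longrightarrow> mdist Y (f x) (f y) \<le> H * mdist Y (f x) (f z))"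

lemma relative_distortion_leD:
  assumes "relative_distortion_le X Y f R H" "x \<in> mspace X" "y \<in> mspace X" "z \<in> mspace X"
    and "mdist X x y \<le> R * mdist X x z"
  shows "mdist Y (f x) (f y) \<le> H * mdist Y (f x) (f z)"
  using assms unfolding relative_distortion_le_def by blast

lemma quasisymmetric_embedding_in_mspace:
  assumes "quasisymmetric_embedding X Y f" "x \<in> mspace X"
  shows "f x \<in> mspace Y"
  using assms continuous_map_image_subset_topspace
  by (fastforce simp: quasisymmetric_embedding_def)

lemma quasisymmetric_embedding_distortion:
  assumes "quasisymmetric_embedding X Y f"
  obtains \<eta> :: "real \<Rightarrow> real" where "continuous_on {0..} \<eta>"
    and "\<And>x y z. \<lbrakk>x \<in> mspace X; y \<in> mspace X; z \<in> mspace X; x \<noteq> y; x \<noteq> z; y \<noteq> z\<rbrakk> \<Longrightarrow>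
      mdist Y (f x) (f y) \<le> \<eta> (mdist X x y / mdist X x z) * mdist Y (f x) (f z)"
proof -
  have inj: "inj_on f (mspace X)"
    using assms by (simp add: quasisymmetric_embedding_def)
  obtain \<eta> \<eta>' :: "real \<Rightarrow> real" where "homeomorphism {0..} {0..} \<eta> \<eta>'"
    and quotient: "\<And>x y z. \<lbrakk>x \<in> mspace X; y \<in> mspace X; z \<in> mspace X; x \<noteq> y; x \<noteq> z; y \<noteq> z\<rbrakk> \<Longrightarrow>
        mdist Y (f x) (f y) / mdist Y (f x) (f z) \<le> \<eta> (mdist X x y / mdist X x z)"
    using assms by (auto simp: quasisymmetric_embedding_def quasisymmetric_map_def)
  have "mdist Y (f x) (f y) \<le> \<eta> (mdist X x y / mdist X x z) * mdist Y (f x) (f z)"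
    if "x \<in> mspace X" "y \<in> mspace X" "z \<in> mspace X" "x \<noteq> y" "x \<noteq> z" "y \<noteq> z" for x y z
  proof -
    have "f x \<noteq> f z" "f x \<in> mspace Y" "f z \<in> mspace Y"
      using that inj quasisymmetric_embedding_in_mspace[OF assms] by (auto simp: inj_on_def)
    then have "0 < mdist Y (f x) (f z)"
      by (simp add: Metric_space.mdist_pos_eq[OF Metric_space_mspace_mdist])
    then show ?thesis
      using quotient[OF that] by (simp add: pos_divide_le_eq)
  qed
  then show thesis
    using that \<open>homeomorphism {0..} {0..} \<eta> \<eta>'\<close> by (auto simp: homeomorphism_def)
qed

lemma quasisymmetric_embedding_imp_relative_distortion_le:
  assumes "quasisymmetric_embedding X Y f"
  obtains H where "1 \<le> H" "relative_distortion_le X Y f R H"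
proof -
  obtain \<eta> :: "real \<Rightarrow> real" where "continuous_on {0..} \<eta>"
    and \<eta>: "\<And>x y z. \<lbrakk>x \<in> mspace X; y \<in> mspace X; z \<in> mspace X; x \<noteq> y; x \<noteq> z; y \<noteq> z\<rbrakk> \<Longrightarrow>
        mdist Y (f x) (f y) \<le> \<eta> (mdist X x y / mdist X x z) * mdist Y (f x) (f z)"
    using quasisymmetric_embedding_distortion[OF assms] by blast
  then have "bdd_above (\<eta> ` {0..R})"
    by (intro bounded_imp_bdd_above compact_imp_bounded compact_continuous_image)
      (auto intro: continuous_on_subset)
  then obtain B where B: "\<And>v. v \<in> {0..R} \<Longrightarrow> \<eta> v \<le> B"
    by (metis bdd_above_def imageI)
  define H where "H = max 1 B"
  have "mdist Y (f x) (f y) \<le> H * mdist Y (f x) (f z)"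
    if xyz: "x \<in> mspace X" "y \<in> mspace X" "z \<in> mspace X"
      and le: "mdist X x y \<le> R * mdist X x z" for x y z
  proof (cases "x = y \<or> x = z \<or> y = z")
    case True
    then have "x = y \<or> y = z"
      using le xyz mdist_nonneg[of X x y] by (metis mdist_zero mult_zero_right order.antisym)
    moreover have "mdist Y (f x) (f z) \<le> H * mdist Y (f x) (f z)"
      using mult_right_mono[of 1 H "mdist Y (f x) (f z)"] by (simp add: H_def)
    ultimately show ?thesis
      using quasisymmetric_embedding_in_mspace[OF assms xyz(1)]
      by (metis mdist_nonneg mdist_zero order.trans)
  next
    case False
    then have "0 < mdist X x z"
      using xyz by (simp add: Metric_space.mdist_pos_eq[OF Metric_space_mspace_mdist])
    have "mdist Y (f x) (f y) \<le> \<eta> (mdist X x y / mdist X x z) * mdist Y (f x) (f z)"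
      using \<eta> xyz False by blast
    also have "\<dots> \<le> H * mdist Y (f x) (f z)"
      using \<open>0 < mdist X x z\<close> le B[of "mdist X x y / mdist X x z"]
      by (intro mult_right_mono) (auto simp: H_def pos_divide_le_eq)
    finally show ?thesis .
  qed
  then show thesis
    using that[of H] by (auto simp: relative_distortion_le_def H_def)
qed

lemma relative_distortion_le_iterate:
  assumes distortion: "relative_distortion_le X Y f R H" and "1 \<le> R" "0 \<le> H"
    and conn: "connected_space (mtopology_of X)" and a: "a \<in> mspace X" and z: "z \<in> mspace X"
    and "x \<in> mspace X" "mdist X a z \<le> R ^ t * mdist X a x"
  shows "mdist Y (f a) (f z) \<le> H ^ Suc t * mdist Y (f a) (f x)"
  using assms(7,8)
proof (induction t arbitrary: x)
  case 0
  then have "mdist X a z \<le> R * mdist X a x"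
    using mult_right_mono[OF \<open>1 \<le> R\<close> mdist_nonneg[of X a x]] by simp
  then show ?case
    using relative_distortion_leD[OF distortion a z \<open>x \<in> mspace X\<close>] by simp
next
  case (Suc t)
  have "0 < R ^ t"
    using \<open>1 \<le> R\<close> by simp
  moreover have "mdist X a z / R ^ t \<le> mdist X a z / 1"
    using \<open>1 \<le> R\<close> by (intro divide_left_mono) (auto simp: one_le_power)
  ultimately obtain y where y: "y \<in> mspace X" "mdist X a y = mdist X a z / R ^ t"
    using connected_space_mdist_attains[OF conn a z, of "mdist X a z / R ^ t"] by auto
  have "mdist Y (f a) (f z) \<le> H ^ Suc t * mdist Y (f a) (f y)"
    using y \<open>1 \<le> R\<close> by (intro Suc.IH) auto
  also have "\<dots> \<le> H ^ Suc t * (H * mdist Y (f a) (f x))"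
  proof (rule mult_left_mono)
    have "R ^ t * mdist X a y \<le> R ^ t * (R * mdist X a x)"
      using Suc.prems(2) y(2) \<open>0 < R ^ t\<close> by (simp add: mult_ac)
    then have "mdist X a y \<le> R * mdist X a x"
      using \<open>0 < R ^ t\<close> by (simp only: mult_le_cancel_left_pos)
    then show "mdist Y (f a) (f y) \<le> H * mdist Y (f a) (f x)"
      using relative_distortion_leD[OF distortion a y(1) Suc.prems(1)] by blast
  qed (use \<open>0 \<le> H\<close> in simp)
  finally show ?case
    by (simp add: mult_ac)
qed

lemma relative_distortion_le_imp_lower_hoelder:
  assumes distortion: "relative_distortion_le X Y f R H" and "1 < R" "0 < H"
    and conn: "connected_space (mtopology_of X)" and a: "a \<in> mspace X" and z: "z \<in> mspace X"
    and pos: "0 < mdist Y (f a) (f z)"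
  obtains c where "0 < c"
    and "\<And>x t. \<lbrakk>x \<in> mspace X; (1/R) ^ t \<le> mdist X a x\<rbrakk> \<Longrightarrow> c / H ^ t \<le> mdist Y (f a) (f x)"
proof -
  obtain k where k: "mdist X a z < R ^ k"
    using real_arch_pow[OF \<open>1 < R\<close>] by blast
  define c where "c = mdist Y (f a) (f z) / H ^ Suc k"
  have "c / H ^ t \<le> mdist Y (f a) (f x)" if x: "x \<in> mspace X" "(1/R) ^ t \<le> mdist X a x" for x t
  proof -
    have "mdist X a z \<le> R ^ k * (R ^ t * (1/R) ^ t)"
      using k \<open>1 < R\<close> by (simp flip: power_mult_distrib)
    also have "\<dots> \<le> R ^ k * (R ^ t * mdist X a x)"
      using x(2) \<open>1 < R\<close> by (intro mult_left_mono) auto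
    finally have "mdist X a z \<le> R ^ (k + t) * mdist X a x"
      by (simp add: power_add mult.assoc)
    then have "mdist Y (f a) (f z) \<le> H ^ Suc (k + t) * mdist Y (f a) (f x)"
      using \<open>1 < R\<close> \<open>0 < H\<close> x(1)
      by (intro relative_distortion_le_iterate[OF distortion _ _ conn a z]) auto
    then show ?thesis
      using \<open>0 < H\<close> by (simp add: c_def field_simps power_add)
  qed
  moreover have "0 < c"
    using pos \<open>0 < H\<close> by (simp add: c_def)
  ultimately show thesis
    using that by blast
qed

definition metric_star :: "'a metric \<Rightarrow> 'a \<Rightarrow> real \<Rightarrow> 'a set \<Rightarrow> bool" where
  "metric_star X a s T \<longleftrightarrow>
     T \<subseteq> mspace X \<and> (\<forall>x\<in>T. mdist X a x = s) \<and> separated (mdist X) s T"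

lemma relative_distortion_le_separated_image:
  assumes distortion: "relative_distortion_le X Y f R H" and "1 \<le> R" "0 < H"
    and "a \<in> mspace X" and star: "metric_star X a s T"
    and far: "\<And>x. x \<in> T \<Longrightarrow> \<delta> \<le> mdist Y (f a) (f x)"
  shows "separated (mdist Y) (\<delta> / H) (f ` T)"
  unfolding separated_def pairwise_image
proof (rule pairwiseI, rule impI)
  fix x y assume xy: "x \<in> T" "y \<in> T" "x \<noteq> y"
  have "mdist X x a = s"
    using star xy(1) mdist_commute[of X x a] by (simp add: metric_star_def)
  also have "s \<le> mdist X x y"
    using star xy by (auto simp: metric_star_def separated_def pairwise_def)
  also have "\<dots> \<le> R * mdist X x y"
    using mult_right_mono[OF \<open>1 \<le> R\<close>, of "mdist X x y"] by simp
  finally have "mdist Y (f x) (f a) \<le> H * mdist Y (f x) (f y)"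
    using relative_distortion_leD[OF distortion, of x a y] xy star \<open>a \<in> mspace X\<close>
    by (auto simp: metric_star_def)
  then have "\<delta> \<le> H * mdist Y (f x) (f y)"
    using far[OF xy(1)] by (simp add: mdist_commute)
  then show "\<delta> / H \<le> mdist Y (f x) (f y)"
    using \<open>0 < H\<close> by (simp add: field_simps)
qed

subsection \<open>Branching metrics\<close>

definition scale :: "nat \<Rightarrow> real" where
  "scale n = (1/2) ^ fact n"

lemma scale_pos: "0 < scale n"
  by (simp add: scale_def)

lemma scale_Suc: "scale (Suc n) = scale n ^ Suc n"
  by (simp add: scale_def power_mult[symmetric] algebra_simps power_add)

lemma scale_less_1: "scale n < 1"
  by (simp add: scale_def power_less_one_iff)

lemma scale_antimono: "m \<le> n \<Longrightarrow> scale n \<le> scale m"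
  unfolding scale_def by (intro power_decreasing fact_mono_nat) auto

lemma scale_tendsto_0: "scale \<longlonglongrightarrow> 0"
proof (rule Lim_null_comparison)
  show "\<forall>\<^sub>F n in sequentially. norm (scale n) \<le> (1/2) ^ n"
    unfolding scale_def using fact_ge_self
    by (intro always_eventually allI) (simp add: power_decreasing)
  show "(\<lambda>n. (1/2::real) ^ n) \<longlonglongrightarrow> 0"
    by (rule LIMSEQ_power_zero) simp
qed

lemma eventually_scale_power_le:
  assumes "0 < c" "0 < H"
  shows "\<forall>\<^sub>F n in sequentially. scale n ^ n \<le> c / H ^ fact n"
proof -
  have "(\<lambda>n. H * (1/2) ^ n) \<longlonglongrightarrow> H * 0"
    by (intro tendsto_mult_left LIMSEQ_power_zero) simp
  then have "\<forall>\<^sub>F n in sequentially. H * (1/2) ^ n < 1/2"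
    by (rule order_tendstoD) simp
  moreover have "\<forall>\<^sub>F n in sequentially. scale n < c"
    using order_tendstoD(2)[OF scale_tendsto_0 \<open>0 < c\<close>] .
  ultimately show ?thesis
  proof eventually_elim
    case (elim n)
    have "scale n ^ n * H ^ fact n = (H * (1/2) ^ n) ^ fact n"
      by (simp add: scale_def power_mult_distrib power_mult[symmetric] mult.commute)
    also have "\<dots> \<le> scale n"
      unfolding scale_def using elim(1) \<open>0 < H\<close> by (intro power_mono) auto
    finally show ?case
      using elim(2) \<open>0 < H\<close> by (simp add: pos_le_divide_eq)
  qed
qed

lemma mtopology_of_eqI:
  assumes "uniformly_continuous_map X Y id" "uniformly_continuous_map Y X id"
  shows "mtopology_of X = mtopology_of Y"
proof -
  have "homeomorphic_maps (mtopology_of Y) (mtopology_of X) id id"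
    using assms by (simp add: homeomorphic_maps_def uniformly_continuous_imp_continuous_map)
  then show ?thesis
    by (simp only: homeomorphic_maps_id)
qed

locale branching =
  fixes S :: "'a::metric_space set" and center :: "nat \<Rightarrow> 'a"
  assumes totally_bounded: "totally_bounded S"
    and connected: "connected S"
    and center_in: "center n \<in> S"
    and center_dense: "S \<subseteq> closure (range center)"
    and center_frequently: "\<exists>\<^sub>F n in sequentially. center n = center m"
begin

text \<open>The number of branches exceeds the size of any subset of \<open>S\<close> whose points are
  \<open>scale n ^ n\<close>-separated for \<open>lip n\<close> times the original metric.\<close>

primrec lip :: "nat \<Rightarrow> real" where
  "lip 0 = 1"
| "lip (Suc n) = lip n * Suc (packing_number S (scale n ^ n / lip n))"

definition branches :: "nat \<Rightarrow> nat" where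
  "branches n = Suc (packing_number S (scale n ^ n / lip n))"

definition radius :: "nat \<Rightarrow> real" where
  "radius n = scale n / lip n"

definition tent :: "nat \<Rightarrow> 'a \<Rightarrow> real" where
  "tent n x = min (radius n) (dist (center n) x)"

definition branch_dist :: "nat \<Rightarrow> 'a \<Rightarrow> 'a \<Rightarrow> real" where
  "branch_dist n x y = min (scale n) (lip (Suc n) * \<bar>tent n x - tent n y\<bar>)"

definition branching_dist :: "'a \<Rightarrow> 'a \<Rightarrow> real" where
  "branching_dist x y = (SUP n. max (dist x y) (branch_dist n x y))"

definition branching_metric :: "'a metric" where
  "branching_metric = metric (S, branching_dist)"

declare lip.simps(2) [simp del]

lemma lip_Suc: "lip (Suc n) = lip n * branches n"
  by (simp add: branches_def lip.simps(2))

lemma branches_ge_1: "1 \<le> real (branches n)"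
  by (simp add: branches_def)

lemma lip_ge_1: "1 \<le> lip n"
proof (induction n)
  case (Suc n)
  then show ?case
    using mult_mono[OF Suc branches_ge_1] by (simp add: lip_Suc)
qed simp

lemma lip_pos: "0 < lip n"
  using lip_ge_1[of n] by linarith

lemma lip_mono: "m \<le> n \<Longrightarrow> lip m \<le> lip n"
proof (rule lift_Suc_mono_le[of lip])
  show "lip n \<le> lip (Suc n)" for n
    using mult_left_mono[OF branches_ge_1, of "lip n" n] lip_pos[of n] by (simp add: lip_Suc)
qed

lemma radius_pos: "0 < radius n"
  by (simp add: radius_def scale_pos lip_pos)

lemma radius_le_scale: "radius n \<le> scale n"
  using lip_ge_1[of n] scale_pos[of n] by (simp add: radius_def divide_le_eq lip_pos)

lemma branch_dist_le_scale: "branch_dist n x y \<le> scale n"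
  by (simp add: branch_dist_def)

lemma branch_dist_le_lip: "branch_dist n x y \<le> lip (Suc n) * dist x y"
proof -
  have "\<bar>tent n x - tent n y\<bar> \<le> \<bar>dist (center n) x - dist (center n) y\<bar>"
    by (auto simp: tent_def)
  also have "\<dots> \<le> dist x y"
    using abs_dist_diff_le[of x "center n" y] by (simp add: dist_commute)
  finally show ?thesis
    using lip_pos[of "Suc n"] unfolding branch_dist_def by (auto intro!: min.coboundedI2)
qed

lemma branch_dist_commute: "branch_dist n x y = branch_dist n y x"
  by (simp add: branch_dist_def abs_minus_commute)

lemma branch_dist_refl: "branch_dist n x x = 0"
  using scale_pos[of n] by (simp add: branch_dist_def)

lemma branch_dist_triangle: "branch_dist n x z \<le> branch_dist n x y + branch_dist n y z"
proof -
  define L where "L = lip (Suc n)"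
  have "0 \<le> L"
    using lip_pos[of "Suc n"] by (simp add: L_def)
  have "\<bar>tent n x - tent n z\<bar> \<le> \<bar>tent n x - tent n y\<bar> + \<bar>tent n y - tent n z\<bar>"
    by linarith
  then have "L * \<bar>tent n x - tent n z\<bar> \<le> L * \<bar>tent n x - tent n y\<bar> + L * \<bar>tent n y - tent n z\<bar>"
    using \<open>0 \<le> L\<close> by (metis distrib_left mult_left_mono)
  moreover have "0 \<le> L * \<bar>tent n x - tent n y\<bar>" "0 \<le> L * \<bar>tent n y - tent n z\<bar>"
    using \<open>0 \<le> L\<close> by simp_all
  ultimately show ?thesis
    using scale_pos[of n] unfolding branch_dist_def L_def by linarith
qed

lemma branch_dist_eq_scale:
  assumes "radius n / branches n \<le> \<bar>tent n x - tent n y\<bar>"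
  shows "branch_dist n x y = scale n"
proof -
  have "scale n = lip (Suc n) * (radius n / branches n)"
    using lip_pos[of n] branches_ge_1[of n] by (simp add: lip_Suc radius_def)
  also have "\<dots> \<le> lip (Suc n) * \<bar>tent n x - tent n y\<bar>"
    using assms lip_pos[of "Suc n"] by (intro mult_left_mono) auto
  finally show ?thesis
    by (simp add: branch_dist_def)
qed

lemma branch_dist_away_from_center:
  assumes "radius n \<le> dist (center n) x" "radius n \<le> dist (center n) y"
  shows "branch_dist n x y = 0"
  using assms scale_pos[of n] by (simp add: branch_dist_def tent_def)

lemma branching_dist_le_iff:
  "branching_dist x y \<le> c \<longleftrightarrow> dist x y \<le> c \<and> (\<forall>n. branch_dist n x y \<le> c)"
proof -
  have "max (dist x y) (branch_dist n x y) \<le> max (dist x y) 1" for n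
    using branch_dist_le_scale[of n x y] scale_less_1[of n] by auto
  then have "bdd_above (range (\<lambda>n. max (dist x y) (branch_dist n x y)))"
    by (rule bdd_aboveI2)
  then show ?thesis
    by (auto simp: branching_dist_def cSUP_le_iff)
qed

lemma dist_le_branching_dist: "dist x y \<le> branching_dist x y"
  and branch_dist_le_branching_dist: "branch_dist n x y \<le> branching_dist x y"
  using branching_dist_le_iff[of x y "branching_dist x y"] by auto

lemma branching_dist_refl [simp]: "branching_dist x x = 0"
proof (rule antisym)
  show "branching_dist x x \<le> 0"
    by (simp add: branching_dist_le_iff branch_dist_refl)
qed (use dist_le_branching_dist[of x x] in simp)

lemma Metric_space_branching_dist: "Metric_space S branching_dist"
proof
  show "0 \<le> branching_dist x y" for x y
    using dist_le_branching_dist[of x y] zero_le_dist[of x y] by linarith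
  show "branching_dist x y = branching_dist y x" for x y
    by (simp add: branching_dist_def branch_dist_commute dist_commute)
  show "branching_dist x y = 0 \<longleftrightarrow> x = y" for x y
    using dist_le_branching_dist[of x y] by auto
  show "branching_dist x z \<le> branching_dist x y + branching_dist y z" for x y z
    unfolding branching_dist_le_iff
  proof (intro conjI allI)
    show "dist x z \<le> branching_dist x y + branching_dist y z"
      using dist_triangle[of x z y] dist_le_branching_dist[of x y] dist_le_branching_dist[of y z]
      by linarith
    show "branch_dist n x z \<le> branching_dist x y + branching_dist y z" for n
      using branch_dist_triangle[of n x z y] branch_dist_le_branching_dist[of n x y]
        branch_dist_le_branching_dist[of n y z]
      by linarith
  qed
qed

lemma mspace_branching_metric [simp]: "mspace branching_metric = S"
  by (simp add: branching_metric_def Metric_space.mspace_metric[OF Metric_space_branching_dist])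

lemma mdist_branching_metric [simp]: "mdist branching_metric = branching_dist"
  by (simp add: branching_metric_def Metric_space.mdist_metric[OF Metric_space_branching_dist])

lemma branching_dist_le_max:
  assumes "\<And>m. n \<le> m \<Longrightarrow> branch_dist m x y \<le> s"
  shows "branching_dist x y \<le> max (lip n * dist x y) s"
  unfolding branching_dist_le_iff
proof (intro conjI allI)
  show "dist x y \<le> max (lip n * dist x y) s"
    using mult_right_mono[OF lip_ge_1, of "dist x y" n] by simp
  fix m
  show "branch_dist m x y \<le> max (lip n * dist x y) s"
  proof (cases "m < n")
    case True
    then have "lip (Suc m) * dist x y \<le> lip n * dist x y"
      by (intro mult_right_mono lip_mono) auto
    then show ?thesis
      using branch_dist_le_lip[of m x y] by linarith
  qed (use assms in \<open>simp add: max.coboundedI2\<close>)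
qed

lemma branching_dist_le_scale:
  assumes "dist x y \<le> radius n"
  shows "branching_dist x y \<le> scale n"
proof -
  have "branch_dist m x y \<le> scale n" if "n \<le> m" for m
    using branch_dist_le_scale[of m x y] scale_antimono[OF that] by linarith
  moreover have "lip n * dist x y \<le> scale n"
    using assms lip_pos[of n] by (simp add: radius_def field_simps)
  ultimately show ?thesis
    using branching_dist_le_max[of n x y "scale n"] by simp
qed

lemma branching_dist_away_from_center:
  assumes "radius n \<le> dist (center n) x" "radius n \<le> dist (center n) y"
  shows "branching_dist x y \<le> max (lip n * dist x y) (scale (Suc n))"
proof (rule branching_dist_le_max)
  fix m assume "n \<le> m"
  then consider (same) "m = n" | (later) "Suc n \<le> m"
    by linarith
  then show "branch_dist m x y \<le> scale (Suc n)"
  proof cases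
    case same
    then show ?thesis
      using branch_dist_away_from_center[OF assms] scale_pos[of "Suc n"] by simp
  next
    case later
    then show ?thesis
      using branch_dist_le_scale[of m x y] scale_antimono[of "Suc n" m] by linarith
  qed
qed

lemma mtopology_of_branching_metric: "mtopology_of branching_metric = top_of_set S"
proof -
  have "mtopology_of branching_metric = mtopology_of (submetric euclidean_metric S)"
  proof (rule mtopology_of_eqI)
    show "uniformly_continuous_map branching_metric (submetric euclidean_metric S) id"
      using dist_le_branching_dist by (auto simp: uniformly_continuous_map_def intro: le_less_trans)
    have "\<exists>\<sigma>>0. \<forall>x y. dist x y < \<sigma> \<longrightarrow> branching_dist x y < \<epsilon>" if "0 < \<epsilon>" for \<epsilon>
    proof -
      obtain n where "scale n < \<epsilon>"
        using order_tendstoD(2)[OF scale_tendsto_0 \<open>0 < \<epsilon>\<close>]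
        by (auto simp: eventually_sequentially)
      then have "branching_dist x y < \<epsilon>" if "dist x y < radius n" for x y
        using branching_dist_le_scale[of x y n] that by simp
      then show ?thesis
        using radius_pos by blast
    qed
    then show "uniformly_continuous_map (submetric euclidean_metric S) branching_metric id"
      by (simp add: uniformly_continuous_map_def) metis
  qed
  then show ?thesis
    by (simp add: mtopology_of_submetric)
qed

lemma connected_space_top_of_S: "connected_space (top_of_set S)"
  using connected by (simp add: connectedin_def flip: connectedin_iff_connected)

lemma scale_le_branching_dist_equispaced:
  fixes i j :: nat
  assumes "dist (center n) x = radius n * i / branches n"
    and "dist (center n) y = radius n * j / branches n"
    and "i \<le> branches n" "j \<le> branches n" "i \<noteq> j"
  shows "scale n \<le> branching_dist x y"
proof -
  let ?\<delta> = "radius n / branches n"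
  have "radius n * l / branches n \<le> radius n" if "l \<le> branches n" for l
    using that radius_pos[of n] branches_ge_1[of n] by (simp add: divide_le_eq)
  then have "tent n x = ?\<delta> * i" "tent n y = ?\<delta> * j"
    using assms by (simp_all add: tent_def)
  then have "\<bar>tent n x - tent n y\<bar> = ?\<delta> * \<bar>real i - real j\<bar>"
    using radius_pos[of n] by (simp add: abs_mult flip: right_diff_distrib diff_divide_distrib)
  moreover have "?\<delta> * 1 \<le> ?\<delta> * \<bar>real i - real j\<bar>"
    using \<open>i \<noteq> j\<close> radius_pos[of n] by (intro mult_left_mono) auto
  ultimately show ?thesis
    using branch_dist_eq_scale[of n x y] branch_dist_le_branching_dist[of n x y] by simp
qed

lemma exists_branch_points:
  assumes "z \<in> S" "radius n \<le> dist (center n) z"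
  obtains T where "metric_star branching_metric (center n) (scale n) T" "card T = branches n"
proof -
  let ?r = "radius n" and ?N = "branches n"
  obtain x where x_0: "x 0 = center n" and x: "\<And>i. i \<le> ?N \<Longrightarrow> x i \<in> S"
    and dist_x: "\<And>i. i \<le> ?N \<Longrightarrow> dist (center n) (x i) = ?r * i / ?N"
    using connected_space_equispaced_points[of "submetric euclidean_metric S" "center n" z ?r ?N]
      connected_space_top_of_S center_in[of n] assms radius_pos[of n]
    by (auto simp: mtopology_of_submetric)
  have apart: "scale n \<le> branching_dist (x i) (x j)" if "i \<le> ?N" "j \<le> ?N" "i \<noteq> j" for i j
    using that scale_le_branching_dist_equispaced dist_x by blast
  have "inj_on x {1..?N}"
  proof (rule inj_onI, rule ccontr)
    fix i j assume "i \<in> {1..?N}" "j \<in> {1..?N}" "x i = x j" "i \<noteq> j"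
    then show False
      using apart[of i j] scale_pos[of n] by simp
  qed
  then have "card (x ` {1..?N}) = ?N"
    by (simp add: card_image)
  moreover have "branching_dist (center n) (x i) = scale n" if "1 \<le> i" "i \<le> ?N" for i
  proof (rule order.antisym)
    have "dist (center n) (x i) \<le> ?r"
      using that radius_pos[of n] branches_ge_1[of n] by (simp add: dist_x divide_le_eq)
    then show "branching_dist (center n) (x i) \<le> scale n"
      by (rule branching_dist_le_scale)
    show "scale n \<le> branching_dist (center n) (x i)"
      using that apart[of 0 i] by (simp add: x_0)
  qed
  moreover have "separated branching_dist (scale n) (x ` {1..?N})"
    unfolding separated_def pairwise_image by (intro pairwiseI impI apart) auto
  ultimately show thesis
    using that[of "x ` {1..?N}"] x by (simp add: metric_star_def image_subset_iff)
qed

lemma separated_card_less_branches: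
  assumes "T \<subseteq> S" "separated branching_dist (scale n ^ n) T"
    and away: "\<And>x. x \<in> T \<Longrightarrow> radius n \<le> dist (center n) x"
  shows "card T < branches n"
proof -
  have "scale (Suc n) < scale n ^ n"
    unfolding scale_Suc by (intro power_strict_decreasing scale_pos scale_less_1) simp
  have "separated dist (scale n ^ n / lip n) T"
    unfolding separated_def
  proof (rule pairwiseI)
    fix x y assume xy: "x \<in> T" "y \<in> T" "x \<noteq> y"
    then have "scale n ^ n \<le> branching_dist x y"
      using assms(2) by (simp add: separated_def pairwise_def)
    then have "scale n ^ n \<le> lip n * dist x y"
      using branching_dist_away_from_center[OF away[OF xy(1)] away[OF xy(2)]]
        \<open>scale (Suc n) < scale n ^ n\<close> by linarith
    then show "scale n ^ n / lip n \<le> dist x y"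
      using lip_pos[of n] by (simp add: divide_le_eq mult.commute)
  qed
  then show ?thesis
    using card_le_packing_number[OF totally_bounded _ \<open>T \<subseteq> S\<close>, of "scale n ^ n / lip n"]
      scale_pos[of n] lip_pos[of n]
    by (simp add: branches_def less_Suc_eq_le)
qed

lemma eventually_image_away_from_point:
  assumes "continuous_on S f" "a \<in> S" "f a \<noteq> a"
  shows "\<forall>\<^sub>F n in sequentially. \<forall>x\<in>S. branching_dist a x \<le> scale n \<longrightarrow> radius n \<le> dist a (f x)"
proof -
  define \<tau> where "\<tau> = dist a (f a) / 2"
  have "0 < \<tau>"
    using assms(3) by (simp add: \<tau>_def)
  then obtain \<sigma> where "0 < \<sigma>" and \<sigma>: "\<And>x. \<lbrakk>x \<in> S; dist x a < \<sigma>\<rbrakk> \<Longrightarrow> dist (f x) (f a) < \<tau>"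
    using assms(1,2) unfolding continuous_on_iff by metis
  have "\<forall>\<^sub>F n in sequentially. scale n < min \<sigma> \<tau>"
    using \<open>0 < \<tau>\<close> \<open>0 < \<sigma>\<close> by (intro order_tendstoD(2)[OF scale_tendsto_0]) simp
  then show ?thesis
  proof eventually_elim
    case (elim n)
    have "radius n \<le> dist a (f x)" if "x \<in> S" "branching_dist a x \<le> scale n" for x
    proof -
      have "dist (f x) (f a) < \<tau>"
        using that elim dist_le_branching_dist[of a x] by (intro \<sigma>) (auto simp: dist_commute)
      moreover have "2 * \<tau> \<le> dist a (f x) + dist (f x) (f a)"
        by (simp add: \<tau>_def dist_triangle)
      ultimately show ?thesis
        using elim radius_le_scale[of n] by simp
    qed
    then show ?case
      by blast
  qed
qed

lemma eventually_star_image_separated: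
  assumes f: "quasisymmetric_embedding branching_metric branching_metric f"
    and "a \<in> S" "z \<in> S" "z \<noteq> a"
  shows "\<forall>\<^sub>F n in sequentially. \<forall>T. metric_star branching_metric a (scale n) T \<longrightarrow>
           separated branching_dist (scale n ^ n) (f ` T)"
proof -
  let ?X = branching_metric
  obtain H where H: "1 \<le> H" and distortion: "relative_distortion_le ?X ?X f 2 H"
    using quasisymmetric_embedding_imp_relative_distortion_le[OF f] by metis
  have "f a \<noteq> f z"
    using f assms(2-4) by (auto simp: quasisymmetric_embedding_def inj_on_def)
  then have pos: "0 < mdist ?X (f a) (f z)"
    using dist_le_branching_dist[of "f a" "f z"]
    by (metis less_le_trans mdist_branching_metric zero_less_dist_iff)
  have "connected_space (mtopology_of ?X)"
    by (simp add: mtopology_of_branching_metric connected_space_top_of_S)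
  then obtain c where "0 < c" and
    c: "\<And>x t. \<lbrakk>x \<in> S; (1/2) ^ t \<le> branching_dist a x\<rbrakk> \<Longrightarrow> c / H ^ t \<le> branching_dist (f a) (f x)"
    using relative_distortion_le_imp_lower_hoelder[OF distortion _ _ _ _ _ pos] H assms(2,3) by auto
  have "\<forall>\<^sub>F n in sequentially. scale n ^ n \<le> c / H / H ^ fact n"
    using \<open>0 < c\<close> H by (intro eventually_scale_power_le) auto
  then show ?thesis
  proof (rule eventually_mono, intro allI impI)
    fix n T assume n: "scale n ^ n \<le> c / H / H ^ fact n" and T: "metric_star ?X a (scale n) T"
    have "c / H ^ fact n \<le> mdist ?X (f a) (f x)" if "x \<in> T" for x
      using c[of x "fact n"] T that by (auto simp: metric_star_def scale_def)
    then have "separated (mdist ?X) (c / H ^ fact n / H) (f ` T)"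
      using H T \<open>a \<in> S\<close> by (intro relative_distortion_le_separated_image[OF distortion]) auto
    then have "separated (mdist ?X) (scale n ^ n) (f ` T)"
      by (rule separated_mono) (use n in \<open>simp add: mult.commute\<close>)
    then show "separated branching_dist (scale n ^ n) (f ` T)"
      by simp
  qed
qed

lemma quasisymmetric_embedding_fixes_center:
  assumes f: "quasisymmetric_embedding branching_metric branching_metric f"
  shows "f (center m) = center m"
proof (rule ccontr)
  let ?a = "center m"
  assume moved: "f ?a \<noteq> ?a"
  have inj: "inj_on f S" and cont: "continuous_on S f" and fS: "f ` S \<subseteq> S"
    using f by (auto simp: quasisymmetric_embedding_def mtopology_of_branching_metric)
  have "f ?a \<in> S"
    using center_in fS by blast
  have "\<forall>\<^sub>F n in sequentially.
      (\<forall>T. metric_star branching_metric ?a (scale n) T \<longrightarrow>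
        separated branching_dist (scale n ^ n) (f ` T)) \<and>
      (\<forall>x\<in>S. branching_dist ?a x \<le> scale n \<longrightarrow> radius n \<le> dist ?a (f x))"
    by (intro eventually_conj eventually_star_image_separated[OF f center_in \<open>f ?a \<in> S\<close> moved]
        eventually_image_away_from_point[OF cont center_in moved])
  then obtain n where n: "center n = ?a"
    and star_image: "\<And>T. metric_star branching_metric ?a (scale n) T \<Longrightarrow>
      separated branching_dist (scale n ^ n) (f ` T)"
    and away: "\<And>x. \<lbrakk>x \<in> S; branching_dist ?a x \<le> scale n\<rbrakk> \<Longrightarrow> radius n \<le> dist ?a (f x)"
    using frequently_ex[OF frequently_eventually_conj[OF center_frequently[of m]]] by blast
  have "radius n \<le> dist (center n) (f ?a)"
    using away[of ?a] center_in[of m] scale_pos[of n] by (simp add: n)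
  then obtain T where T: "metric_star branching_metric ?a (scale n) T" and "card T = branches n"
    using exists_branch_points[OF \<open>f ?a \<in> S\<close>, of n] n by metis
  have "T \<subseteq> S" and dist_T: "\<And>x. x \<in> T \<Longrightarrow> branching_dist ?a x = scale n"
    using T by (simp_all add: metric_star_def)
  have "card (f ` T) < branches n"
    using \<open>T \<subseteq> S\<close> fS away dist_T n star_image[OF T]
    by (intro separated_card_less_branches) (auto simp: subset_iff)
  moreover have "card (f ` T) = branches n"
    using card_image[OF inj_on_subset[OF inj \<open>T \<subseteq> S\<close>]] \<open>card T = branches n\<close> by simp
  ultimately show False
    by simp
qed

lemma quasisymmetrically_co_Hopfian_branching_metric:
  "quasisymmetrically_co_Hopfian branching_metric"
  unfolding quasisymmetrically_co_Hopfian_def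
proof (intro allI impI)
  fix f assume f: "quasisymmetric_embedding branching_metric branching_metric f"
  then have "continuous_map (top_of_set S) euclidean f"
    by (auto simp: quasisymmetric_embedding_def mtopology_of_branching_metric)
  moreover have "x \<in> top_of_set S closure_of range center" if "x \<in> S" for x
    using that center_dense center_in
    by (auto simp: closure_of_subtopology Int_absorb1 image_subset_iff)
  moreover have "continuous_map (top_of_set S) euclidean id"
    by simp
  ultimately have "f x = id x" if "x \<in> S" for x
    using forall_in_closure_of_eq[OF _ Hausdorff_space_euclidean,
        of x "top_of_set S" "range center" f id]
      quasisymmetric_embedding_fixes_center[OF f] that by auto
  then show "f ` mspace branching_metric = mspace branching_metric"
    by simp
qed

end

lemma countable_enumeration_frequently:
  assumes "countable A" "A \<noteq> {}"
  obtains f :: "nat \<Rightarrow> 'a" where "range f = A" "\<And>m. \<exists>\<^sub>F n in sequentially. f n = f m"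
proof -
  define f where "f n = from_nat_into A (fst (prod_decode n))" for n
  have "surj (\<lambda>n. fst (prod_decode n))"
    by (rule surjI[of _ "\<lambda>i. prod_encode (i, 0)"]) simp
  then have "range f = range (from_nat_into A)"
    unfolding f_def by (metis image_image)
  moreover have "\<exists>\<^sub>F n in sequentially. f n = f m" for m
    unfolding frequently_sequentially
  proof
    fix n0
    have "f (prod_encode (fst (prod_decode m), n0)) = f m"
      by (simp add: f_def)
    then show "\<exists>n\<ge>n0. f n = f m"
      using le_prod_encode_2 by blast
  qed
  ultimately show thesis
    using that range_from_nat_into[OF assms(2,1)] by metis
qed

theorem compatible_quasisymmetrically_co_Hopfian_metric:
  fixes S :: "'a::{metric_space, second_countable_topology} set"
  assumes "totally_bounded S" "connected S" "S \<noteq> {}"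
  obtains X where "mtopology_of X = top_of_set S" "quasisymmetrically_co_Hopfian X"
proof -
  obtain C where C: "countable C" "C \<subseteq> S" "S \<subseteq> closure C"
    using separable by metis
  then have "C \<noteq> {}"
    using assms(3) by auto
  then obtain center :: "nat \<Rightarrow> 'a" where center: "range center = C"
    "\<And>m. \<exists>\<^sub>F n in sequentially. center n = center m"
    using countable_enumeration_frequently C(1) by metis
  interpret branching S center
    using assms C center by unfold_locales auto
  show thesis
    by (rule that[OF mtopology_of_branching_metric quasisymmetrically_co_Hopfian_branching_metric])
qed

subsection \<open>Connectedness of the carpet\<close>

lemma connected_Diff_UN_open:
  assumes "finite I" "connected U"
    and "\<And>i. i \<in> I \<Longrightarrow> open (V i)" "\<And>i. i \<in> I \<Longrightarrow> closed (C i)"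
    and "\<And>i. i \<in> I \<Longrightarrow> V i \<subseteq> C i" "\<And>i. i \<in> I \<Longrightarrow> C i \<subseteq> U"
    and "\<And>i. i \<in> I \<Longrightarrow> connected (C i - V i)"
    and "\<And>i j. \<lbrakk>i \<in> I; j \<in> I; i \<noteq> j\<rbrakk> \<Longrightarrow> C i \<inter> V j = {}"
  shows "connected (U - (\<Union>i\<in>I. V i))"
  using assms
proof (induction I rule: finite_induct)
  case (insert i I)
  have "connected (U - (\<Union>j\<in>I. V j) - V i)"
  proof (rule connected_diff_open_from_closed)
    show "C i \<subseteq> U - (\<Union>j\<in>I. V j)"
      using insert.prems(5)[of i] insert.prems(7)[of i] insert.hyps(2) by blast
    show "connected (U - (\<Union>j\<in>I. V j))"
      using insert.prems by (intro insert.IH) auto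
  qed (use insert.prems in auto)
  moreover have "U - (\<Union>j\<in>insert i I. V j) = U - (\<Union>j\<in>I. V j) - V i"
    by auto
  ultimately show ?case
    by simp
qed simp

lemma connected_cbox_Diff_box:
  fixes a b :: "'a::euclidean_space"
  assumes "box a b \<noteq> {}" "DIM('a) \<noteq> 1"
  shows "connected (cbox a b - box a b)"
proof -
  have "interior (cbox a b) \<noteq> {}"
    using assms(1) by simp
  then have "aff_dim (cbox a b) \<noteq> 1" "rel_frontier (cbox a b) = cbox a b - box a b"
    using assms(2)
    by (simp_all add: aff_dim_nonempty_interior rel_frontier_nonempty_interior frontier_cbox)
  then show ?thesis
    by (metis connected_sphere_gen convex_box(1) bounded_cbox)
qed

definition child_corner :: "nat \<Rightarrow> real \<times> real \<Rightarrow> nat \<Rightarrow> nat \<Rightarrow> real \<times> real" where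
  "child_corner n c i j = (fst c + i / 3 ^ Suc n, snd c + j / 3 ^ Suc n)"

definition carpet_square :: "nat \<Rightarrow> real \<times> real \<Rightarrow> (real \<times> real) set" where
  "carpet_square n c = {fst c..fst c + 1 / 3 ^ n} \<times> {snd c..snd c + 1 / 3 ^ n}"

lemma carpet_corners_Suc:
  "carpet_corners (Suc n) =
     {child_corner n c i j | c i j. c \<in> carpet_corners n \<and> i < 3 \<and> j < 3 \<and> (i, j) \<noteq> (1, 1)}"
  by (auto simp: child_corner_def)

declare carpet_corners.simps(2) [simp del]

lemma finite_carpet_corners: "finite (carpet_corners n)"
proof (induction n)
  case (Suc n)
  have "carpet_corners (Suc n) \<subseteq>
      (\<lambda>(c, i, j). child_corner n c i j) ` (carpet_corners n \<times> {..<3} \<times> {..<3})"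
    by (force simp: carpet_corners_Suc)
  then show ?case
    by (rule finite_subset) (simp add: Suc)
qed simp

lemma carpet_corners_grid:
  assumes "c \<in> carpet_corners n"
  obtains a b :: int where "c = (a / 3 ^ n, b / 3 ^ n)"
  using assms
proof (induction n arbitrary: c thesis)
  case 0
  then show ?case
    by (simp add: 0(1)[of 0 0])
next
  case (Suc n)
  then obtain c' i j where c: "c = child_corner n c' i j" and "c' \<in> carpet_corners n"
    by (auto simp: carpet_corners_Suc)
  then obtain a b :: int where "c' = (a / 3 ^ n, b / 3 ^ n)"
    using Suc.IH by blast
  then have "c = (of_int (3 * a + int i) / 3 ^ Suc n, of_int (3 * b + int j) / 3 ^ Suc n)"
    by (simp add: c child_corner_def field_simps)
  then show ?case
    by (rule Suc.prems)
qed

lemma carpet_square_child_subset: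
  assumes "i < 3" "j < 3"
  shows "carpet_square (Suc n) (child_corner n c i j) \<subseteq> carpet_square n c"
proof -
  have "z \<le> z + real l / 3 ^ Suc n \<and> z + real l / 3 ^ Suc n + 1 / 3 ^ Suc n \<le> z + 1 / 3 ^ n"
    if "l < 3" for z :: real and l
    using that by (auto simp: field_simps)
  from this[OF assms(1), of "fst c"] this[OF assms(2), of "snd c"] show ?thesis
    unfolding carpet_square_def child_corner_def fst_conv snd_conv
    by (intro Sigma_mono) (simp_all only: atLeastatMost_subset_iff simp_thms)
qed

lemma triadic_intervals_meet_imp_middle:
  fixes e e' :: int
  assumes "i < 3"
    and "w \<in> {e / 3 ^ n + real i / 3 ^ Suc n..e / 3 ^ n + real i / 3 ^ Suc n + 1 / 3 ^ Suc n}"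
    and "w \<in> {e' / 3 ^ n + 1 / 3 ^ Suc n<..<e' / 3 ^ n + 2 / 3 ^ Suc n}"
  shows "i = 1" "e = e'"
proof -
  define v where "v = w * 3 ^ Suc n"
  have "3 * e + real i \<le> v" "v \<le> 3 * e + real i + 1" "3 * e' + 1 < v" "v < 3 * e' + 2"
    using assms(2,3) by (auto simp: v_def field_simps)
  then have "3 * e + int i < 3 * e' + 2" "3 * e' + 1 < 3 * e + int i + 1"
    by linarith+
  then show "i = 1" "e = e'"
    using assms(1) by presburger+
qed

lemma child_square_meets_open_middle_square:
  assumes "c \<in> carpet_corners n" "d \<in> carpet_corners n" "i < 3" "j < 3"
    and "carpet_square (Suc n) (child_corner n c i j) \<inter> open_middle_square n d \<noteq> {}"
  shows "i = 1" "j = 1" "c = d"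
proof -
  obtain a b a' b' :: int where cd: "c = (a / 3 ^ n, b / 3 ^ n)" "d = (a' / 3 ^ n, b' / 3 ^ n)"
    using carpet_corners_grid assms(1,2) by metis
  obtain u v where "(u, v) \<in> carpet_square (Suc n) (child_corner n c i j)"
      "(u, v) \<in> open_middle_square n d"
    using assms(5) by auto
  then have "i = 1 \<and> a = a'" "j = 1 \<and> b = b'"
    using triadic_intervals_meet_imp_middle[OF assms(3), of u a n a']
      triadic_intervals_meet_imp_middle[OF assms(4), of v b n b']
    by (simp_all add: carpet_square_def child_corner_def open_middle_square_def cd del: power_Suc)
  then show "i = 1" "j = 1" "c = d"
    by (simp_all add: cd)
qed

lemma carpet_square_subset_stage: "c \<in> carpet_corners n \<Longrightarrow> carpet_square n c \<subseteq> carpet_stage n"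
proof (induction n arbitrary: c)
  case 0
  then show ?case
    by (simp add: carpet_square_def)
next
  case (Suc n)
  then obtain c' i j where c: "c = child_corner n c' i j" and c': "c' \<in> carpet_corners n"
    and ij: "i < 3" "j < 3" "(i, j) \<noteq> (1, 1)"
    by (auto simp: carpet_corners_Suc)
  have "carpet_square (Suc n) c \<subseteq> carpet_stage n"
    using carpet_square_child_subset[OF ij(1,2), of n c'] Suc.IH[OF c'] by (simp add: c)
  moreover have "carpet_square (Suc n) c \<inter> open_middle_square n d = {}"
    if "d \<in> carpet_corners n" for d
    using child_square_meets_open_middle_square[OF c' that ij(1,2)] ij(3) by (auto simp: c)
  ultimately show ?case
    by auto
qed

lemma open_middle_square_eq_box:
  "open_middle_square n c = box (child_corner n c 1 1) (child_corner n c 2 2)"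
  by (force simp: open_middle_square_def child_corner_def box_def Basis_prod_def)

lemma middle_carpet_square_eq_cbox:
  "carpet_square (Suc n) (child_corner n c 1 1) =
     cbox (child_corner n c 1 1) (child_corner n c 2 2)"
  by (simp add: carpet_square_def child_corner_def cbox_Pair_eq algebra_simps)

lemma connected_carpet_stage: "connected (carpet_stage n)"
proof (induction n)
  case 0
  show ?case
    by (simp add: connected_Times)
next
  case (Suc n)
  let ?V = "open_middle_square n" and ?C = "\<lambda>c. carpet_square (Suc n) (child_corner n c 1 1)"
  have "connected (carpet_stage n - (\<Union>c\<in>carpet_corners n. ?V c))"
  proof (rule connected_Diff_UN_open[where C = ?C])
    fix c assume c: "c \<in> carpet_corners n"
    show "open (?V c)" "closed (?C c)"
      unfolding open_middle_square_eq_box middle_carpet_square_eq_cbox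
      by (simp_all add: open_box closed_cbox)
    show "?V c \<subseteq> ?C c"
      unfolding open_middle_square_eq_box middle_carpet_square_eq_cbox
      by (rule box_subset_cbox)
    show "?C c \<subseteq> carpet_stage n"
      using carpet_square_child_subset[of 1 1 n c] carpet_square_subset_stage[OF c] by simp
    have "?V c \<noteq> {}"
      by (simp add: open_middle_square_def divide_strict_right_mono not_le)
    then show "connected (?C c - ?V c)"
      unfolding open_middle_square_eq_box middle_carpet_square_eq_cbox
      by (simp add: connected_cbox_Diff_box)
    show "?C c \<inter> ?V d = {}" if "d \<in> carpet_corners n" "c \<noteq> d" for d
      using child_square_meets_open_middle_square(3)[OF c that(1), of 1 1] that(2) by auto
  qed (rule finite_carpet_corners, rule Suc)
  then show ?case
    by simp
qed

lemma compact_carpet_stage: "compact (carpet_stage n)"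
proof (induction n)
  case 0
  show ?case
    by (simp add: compact_Times)
next
  case (Suc n)
  have "open (\<Union>c\<in>carpet_corners n. open_middle_square n c)"
    by (auto simp: open_middle_square_eq_box open_box)
  then show ?case
    using Suc by (simp add: compact_diff)
qed

lemma compact_standard_carpet: "compact standard_carpet"
  unfolding standard_carpet_def
  by (intro compact_Inter) (auto simp: compact_carpet_stage)

lemma connected_standard_carpet: "connected standard_carpet"
proof -
  have "carpet_stage n \<subseteq> carpet_stage m" if "m \<le> n" for m n
    using that by (rule lift_Suc_antimono_le[rotated]) auto
  then show ?thesis
    unfolding standard_carpet_def
    using compact_carpet_stage connected_carpet_stage by (intro connected_nest)
qed

lemma standard_carpet_nonempty: "standard_carpet \<noteq> {}"
proof -
  have corner: "(0, 0) \<in> carpet_corners n" for n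
  proof (induction n)
    case (Suc n)
    then have "child_corner n (0, 0) 0 0 \<in> carpet_corners (Suc n)"
      unfolding carpet_corners_Suc by force
    then show ?case
      by (simp add: child_corner_def)
  qed simp
  have "(0, 0) \<in> carpet_stage n" for n
    using carpet_square_subset_stage[OF corner[of n]]
    by (rule subsetD) (simp add: carpet_square_def)
  then show ?thesis
    by (auto simp: standard_carpet_def)
qed

theorem theorem1p2:
  "\<exists>X :: (real \<times> real) metric.
     metric_sierpinski_carpet X \<and> quasisymmetrically_co_Hopfian X"
proof -
  have "totally_bounded standard_carpet"
    using compact_standard_carpet
    by (simp add: compact_eq_totally_bounded totally_bounded_metric ball_def)
  then obtain X :: "(real \<times> real) metric" where
    "mtopology_of X = top_of_set standard_carpet" "quasisymmetrically_co_Hopfian X"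
    using compatible_quasisymmetrically_co_Hopfian_metric connected_standard_carpet
      standard_carpet_nonempty by metis
  then show ?thesis
    unfolding metric_sierpinski_carpet_def by (metis homeomorphic_space_refl)
qed

end
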